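(* Let $d\ge2$, let $X=\{x_1,\ldots,x_N\}\subset\mathbb S^{d-1}$ be a spherical $2$-design and $U\in O(d)$. Then $$\max_{i,j}\langle Ux_i,x_j\rangle\ge\frac1d.$$ If equality holds, then $N=d+1$, $X$ is (the vertex set of) a regular simplex, and there is a permutation $\pi$ of $\{1,\ldots,N\}$ such that $Ux_i=-x_{\pi(i)}$ for every $i$.
   Context: A finite set $X=\{x_1,\ldots,x_N\}$ of $N$ distinct points of the unit sphere $\mathbb S^{d-1}\subset\mathbb R^d$ is a spherical $t$-design if $\frac1N\sum_i p(x_i)=\int_{\mathbb S^{d-1}}p\,d\sigma$ for every polynomial $p$ of total degree at most $t$, where $\sigma$ is the normalized (probability) surface measure on $\mathbb S^{d-1}$. *)

theory Defs
  imports "HOL-Analysis.Analysis"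
begin

text \<open>
  The normalized surface measure on the unit sphere, given by the usual cone construction: the
  measure of \<open>A\<close> is the share of the unit ball filled by the cone \<open>{r a | 0 < r < 1, a \<in> A}\<close>.
  It is a Borel measure on the ambient space, concentrated on the sphere; the origin, which is not
  sent to the sphere, is a null set.
\<close>

definition sphere_measure :: "(real ^ 'n) measure" where
  "sphere_measure = distr (uniform_measure lborel (ball 0 1)) borel (\<lambda>x. x /\<^sub>R norm x)"

text \<open>
  Real polynomial functions in the coordinates, of total degree at most \<open>t\<close>. The sum
  ranges over all multi-indices \<open>m\<close> with \<open>|m| \<le> t\<close>, of which there are finitely many.
\<close>

definition polynomial_of_degree_le :: "nat \<Rightarrow> (real ^ 'n \<Rightarrow> real) \<Rightarrow> bool" where
  "polynomial_of_degree_le t p \<longleftrightarrow>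
     (\<exists>c :: ('n \<Rightarrow> nat) \<Rightarrow> real. \<forall>x.
        p x = (\<Sum>m | (\<Sum>i\<in>UNIV. m i) \<le> t. c m * (\<Prod>i\<in>UNIV. (x $ i) ^ m i)))"

text \<open>
  The empty set is never a design: for \<open>p = 1\<close> the left-hand side is then 0.
\<close>

definition spherical_design :: "nat \<Rightarrow> (real ^ 'n) set \<Rightarrow> bool" where
  "spherical_design t X \<longleftrightarrow>
     finite X \<and> X \<subseteq> sphere 0 1 \<and>
     (\<forall>p. polynomial_of_degree_le t p \<longrightarrow>
        1 / real (card X) * (\<Sum>x\<in>X. p x) = (\<integral>x. p x \<partial>sphere_measure))"

definition regular_simplex_vertices :: "(real ^ 'n) set \<Rightarrow> bool" where
  "regular_simplex_vertices X \<longleftrightarrow>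
     \<not> affine_dependent X \<and> (\<exists>l. \<forall>x\<in>X. \<forall>y\<in>X. x \<noteq> y \<longrightarrow> dist x y = l)"

end

theory Submission
  imports Defs
begin

text \<open>
  The surface measure is invariant under permutations and sign changes of the coordinates, which
  determines its first and second moments: a 2-design satisfies \<open>\<Sum>x \<bullet> y = 0\<close> and
  \<open>\<Sum>(x \<bullet> y)\<^sup>2 = N / d\<close> for every unit vector \<open>y\<close>. If all inner products \<open>x \<bullet> y\<close> lie in
  \<open>[-1, s]\<close>, then summing \<open>(x \<bullet> y + 1) (s - x \<bullet> y) \<ge> 0\<close> over the design gives \<open>s \<ge> 1 / d\<close>. In the
  case of equality the inner products with \<open>y\<close> are only \<open>-1\<close> and \<open>1 / d\<close>; since their sum vanishes,
  \<open>-y\<close> is a point of the design and \<open>N = d + 1\<close>. Taking \<open>y = U x\<^sub>i\<close> for all \<open>i\<close> yields the permutation,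
  and hence all mutual inner products of the points.
\<close>

section \<open>Polynomial functions of bounded degree\<close>

lemma finite_bounded_multiindices: "finite {m :: 'n::finite \<Rightarrow> nat. sum m UNIV \<le> t}"
proof (rule finite_subset)
  have "m i \<le> t" if "sum m UNIV \<le> t" for m :: "'n \<Rightarrow> nat" and i
    using member_le_sum[of i UNIV m] that by simp
  then show "{m :: 'n \<Rightarrow> nat. sum m UNIV \<le> t} \<subseteq> {m. range m \<subseteq> {..t}}"
    by auto
  show "finite {m :: 'n \<Rightarrow> nat. range m \<subseteq> {..t}}"
    using finite_PiE[of "UNIV :: 'n set" "\<lambda>_. {..t}"]
    by (rule rev_finite_subset) auto
qed

lemma polynomial_of_degree_le_monomial:
  fixes m :: "'n::finite \<Rightarrow> nat"
  assumes "sum m UNIV \<le> t"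
  shows "polynomial_of_degree_le t (\<lambda>x :: real ^ 'n. \<Prod>i\<in>UNIV. (x $ i) ^ m i)"
  unfolding polynomial_of_degree_le_def
proof (intro exI allI)
  fix x :: "real ^ 'n"
  \<comment> \<open>The coefficients are the Kronecker delta at \<open>m\<close>. Finiteness of the
    index set matters here: a sum over an infinite set would be 0 by convention.\<close>
  have "(\<Sum>m' | sum m' UNIV \<le> t. (if m' = m then 1 else 0) * (\<Prod>i\<in>UNIV. (x $ i) ^ m' i))
      = (\<Sum>m' | sum m' UNIV \<le> t. if m' = m then (\<Prod>i\<in>UNIV. (x $ i) ^ m' i) else 0)"
    by (rule sum.cong) auto
  also have "\<dots> = (\<Prod>i\<in>UNIV. (x $ i) ^ m i)"
    using assms by (subst sum.delta[OF finite_bounded_multiindices]) auto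
  finally show "(\<Prod>i\<in>UNIV. (x $ i) ^ m i) =
      (\<Sum>m' | sum m' UNIV \<le> t. (if m' = m then 1 else 0) * (\<Prod>i\<in>UNIV. (x $ i) ^ m' i))"
    by simp
qed

lemma polynomial_of_degree_le_cmult:
  assumes "polynomial_of_degree_le t p"
  shows "polynomial_of_degree_le t (\<lambda>x. a * p x)"
proof -
  obtain c where "\<And>x. p x = (\<Sum>m | sum m UNIV \<le> t. c m * (\<Prod>i\<in>UNIV. (x $ i) ^ m i))"
    using assms unfolding polynomial_of_degree_le_def by auto
  then have "a * p x = (\<Sum>m | sum m UNIV \<le> t. (a * c m) * (\<Prod>i\<in>UNIV. (x $ i) ^ m i))" for x
    by (simp add: sum_distrib_left mult.assoc)
  then show ?thesis
    unfolding polynomial_of_degree_le_def by (intro exI[of _ "\<lambda>m. a * c m"]) auto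
qed

lemma polynomial_of_degree_le_sum:
  assumes "\<And>k. k \<in> K \<Longrightarrow> polynomial_of_degree_le t (p k)"
  shows "polynomial_of_degree_le t (\<lambda>x. \<Sum>k\<in>K. p k x)"
proof -
  obtain c where c: "\<And>k x. k \<in> K \<Longrightarrow>
      p k x = (\<Sum>m | sum m UNIV \<le> t. c k m * (\<Prod>i\<in>UNIV. (x $ i) ^ m i))"
    using assms unfolding polynomial_of_degree_le_def by metis
  have "(\<Sum>k\<in>K. p k x) =
      (\<Sum>m | sum m UNIV \<le> t. (\<Sum>k\<in>K. c k m) * (\<Prod>i\<in>UNIV. (x $ i) ^ m i))" for x
    unfolding sum_distrib_right by (subst sum.swap) (simp add: c)
  then show ?thesis
    unfolding polynomial_of_degree_le_def by (intro exI[of _ "\<lambda>m. \<Sum>k\<in>K. c k m"]) auto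
qed

lemma polynomial_of_degree_le_const: "polynomial_of_degree_le t (\<lambda>x :: real ^ 'n. a)"
  using polynomial_of_degree_le_cmult[OF polynomial_of_degree_le_monomial[of "\<lambda>_. 0"], of t a]
  by simp

lemma polynomial_of_degree_le_inner:
  assumes "1 \<le> t"
  shows "polynomial_of_degree_le t (\<lambda>x :: real ^ 'n. x \<bullet> y)"
proof -
  have "polynomial_of_degree_le t (\<lambda>x :: real ^ 'n. x $ k)" for k
  proof -
    have "(\<Prod>i\<in>UNIV. (x $ i) ^ (if i = k then 1 else 0)) = x $ k" for x :: "real ^ 'n"
    proof -
      have "(\<Prod>i\<in>UNIV. (x $ i) ^ (if i = k then 1 else 0)) = (\<Prod>i\<in>UNIV. if i = k then x $ i else 1)"
        by (rule prod.cong) auto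
      then show ?thesis
        by simp
    qed
    then show ?thesis
      using polynomial_of_degree_le_monomial[of "\<lambda>i. if i = k then 1 else 0" t] assms by simp
  qed
  then have "polynomial_of_degree_le t (\<lambda>x :: real ^ 'n. \<Sum>k\<in>UNIV. y $ k * x $ k)"
    by (intro polynomial_of_degree_le_sum polynomial_of_degree_le_cmult)
  then show ?thesis
    by (simp add: inner_vec_def mult.commute)
qed

lemma polynomial_of_degree_le_inner_mult:
  assumes "2 \<le> t"
  shows "polynomial_of_degree_le t (\<lambda>x :: real ^ 'n. (x \<bullet> y) * (x \<bullet> z))"
proof -
  \<comment> \<open>Adding two unit multi-indices as exponents treats \<open>k = l\<close> and
    \<open>k \<noteq> l\<close> uniformly.\<close>
  have mono: "polynomial_of_degree_le t (\<lambda>x :: real ^ 'n. x $ k * x $ l)" for k l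
  proof -
    have "(\<Prod>i\<in>UNIV. (x $ i) ^ ((if i = k then 1 else 0) + (if i = l then 1 else 0))) = x $ k * x $ l"
      for x :: "real ^ 'n"
    proof -
      have "(\<Prod>i\<in>UNIV. (x $ i) ^ ((if i = k then 1 else 0) + (if i = l then 1 else 0))) =
          (\<Prod>i\<in>UNIV. (if i = k then x $ i else 1) * (if i = l then x $ i else 1))"
        by (rule prod.cong) auto
      then show ?thesis
        by (simp add: prod.distrib)
    qed
    then show ?thesis
      using polynomial_of_degree_le_monomial
        [of "\<lambda>i. (if i = k then 1 else 0) + (if i = l then 1 else 0)" t] assms
      by (simp add: sum.distrib)
  qed
  have "(x \<bullet> y) * (x \<bullet> z) = (\<Sum>k\<in>UNIV. \<Sum>l\<in>UNIV. (y $ k * z $ l) * (x $ k * x $ l))" for x :: "real ^ 'n"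
    by (simp add: inner_vec_def sum_product algebra_simps)
  then show ?thesis
    by (simp only:) (intro polynomial_of_degree_le_sum polynomial_of_degree_le_cmult mono)
qed

section \<open>Invariance of Lebesgue measure and of the sphere measure\<close>

lemma distr_lborel_permute_Basis:
  fixes p :: "'a::euclidean_space \<Rightarrow> 'a"
  assumes p: "bij_betw p Basis Basis"
  shows "distr lborel borel (\<lambda>x. \<Sum>b\<in>Basis. (x \<bullet> p b) *\<^sub>R b) = lborel" (is "distr _ _ ?f = _")
proof (rule sym, rule lborel_eqI)
  \<comment> \<open>Lebesgue measure is determined by its values on boxes. The preimage of a box
    under a coordinate permutation is a box with the same side lengths in another order.\<close>
  fix l u :: 'a
  assume lu: "\<And>b. b \<in> Basis \<Longrightarrow> l \<bullet> b \<le> u \<bullet> b"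
  have f: "?f \<in> borel_measurable lborel"
    by measurable
  define q where "q = inv_into Basis p"
  have q: "bij_betw q Basis Basis"
    unfolding q_def using p by (rule bij_betw_inv_into)
  have pq: "p (q b) = b" "q (p b) = b" "p b \<in> Basis" "q b \<in> Basis" if "b \<in> Basis" for b
    using that p q bij_betw_inv_into_left[OF p] bij_betw_inv_into_right[OF p]
    by (auto simp: q_def dest: bij_betwE)
  \<comment> \<open>\<open>g\<close> is the inverse coordinate permutation; it sends the corners of
    a box to those of its preimage.\<close>
  define g where "g y = (\<Sum>b\<in>Basis. (y \<bullet> q b) *\<^sub>R b)" for y :: 'a
  have g: "g y \<bullet> b = y \<bullet> q b" if "b \<in> Basis" for y b
    using that by (simp add: g_def)
  have "x \<in> ?f -` box l u \<longleftrightarrow> x \<in> box (g l) (g u)" for x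
  proof -
    have "x \<in> ?f -` box l u \<longleftrightarrow> (\<forall>b\<in>Basis. l \<bullet> b < x \<bullet> p b \<and> x \<bullet> p b < u \<bullet> b)"
      by (simp add: mem_box)
    also have "\<dots> \<longleftrightarrow> (\<forall>b\<in>Basis. l \<bullet> q b < x \<bullet> b \<and> x \<bullet> b < u \<bullet> q b)"
      using pq by metis
    finally show ?thesis
      by (simp add: mem_box g)
  qed
  then have "emeasure (distr lborel borel ?f) (box l u) = emeasure lborel (box (g l) (g u))"
    using f by (subst emeasure_distr) (auto intro: arg_cong[of _ _ "emeasure lborel"])
  also have "\<dots> = (\<Prod>b\<in>Basis. (g u - g l) \<bullet> b)"
    using lu pq by (intro emeasure_lborel_box) (simp add: g)
  also have "\<dots> = ennreal (\<Prod>b\<in>Basis. (u - l) \<bullet> q b)"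
    by (simp add: g inner_diff_left)
  also have "\<dots> = ennreal (\<Prod>b\<in>Basis. (u - l) \<bullet> b)"
    by (subst prod.reindex_bij_betw[OF q]) simp
  finally show "emeasure (distr lborel borel ?f) (box l u) = ennreal (\<Prod>b\<in>Basis. (u - l) \<bullet> b)" .
qed simp

text \<open>This is the change of variables for a diagonal map, whose Jacobian factor is the product
  of the \<open>\<bar>c b\<bar>\<close>, hence 1.\<close>

lemma distr_lborel_change_signs:
  fixes c :: "'a::euclidean_space \<Rightarrow> real"
  assumes c: "\<And>b. b \<in> Basis \<Longrightarrow> \<bar>c b\<bar> = 1"
  shows "distr lborel borel (\<lambda>x. \<Sum>b\<in>Basis. (c b * (x \<bullet> b)) *\<^sub>R b) = lborel"
proof -
  have "lborel = density (distr lborel borel (\<lambda>x. 0 + (\<Sum>b\<in>Basis. (c b * (x \<bullet> b)) *\<^sub>R b)))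
      (\<lambda>_. \<Prod>b\<in>Basis. \<bar>c b\<bar>)"
    using c by (intro lborel_affine_euclidean) force+
  then show ?thesis
    using c by (simp add: density_1)
qed

text \<open>The volume of the ball is neither 0 nor infinite, so normalizing by it does give total
  mass 1.\<close>

lemma sphere_measure_UNIV: "measure (sphere_measure :: (real ^ 'n) measure) UNIV = 1"
proof -
  have "emeasure lborel (ball 0 1 :: (real ^ 'n) set) \<noteq> 0"
    using content_ball_pos[of 1 "0 :: real ^ 'n"] by (auto simp: measure_def)
  moreover have "emeasure lborel (ball 0 1 :: (real ^ 'n) set) \<noteq> \<infinity>"
    using emeasure_bounded_finite[of "ball 0 1 :: (real ^ 'n) set"] by simp
  ultimately have "emeasure (uniform_measure lborel (ball 0 1 :: (real ^ 'n) set)) UNIV = 1"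
    by (subst emeasure_uniform_measure) (auto simp: ennreal_divide_self less_top)
  then show ?thesis
    by (simp add: sphere_measure_def measure_def emeasure_distr)
qed

text \<open>A norm-preserving linear map preserves the unit ball and commutes with radial
  projection, so its invariance of Lebesgue measure descends to the sphere.\<close>

lemma integral_sphere_measure_isometry:
  fixes f :: "real ^ 'n \<Rightarrow> real ^ 'n" and g :: "real ^ 'n \<Rightarrow> real"
  assumes f: "linear f" "\<And>x. norm (f x) = norm x" "distr lborel borel f = lborel"
    and [measurable]: "g \<in> borel_measurable borel"
  shows "(\<integral>x. g (f x) \<partial>sphere_measure) = (\<integral>x. g x \<partial>sphere_measure)"
proof -
  have [measurable]: "f \<in> borel_measurable borel"
    using f(1) by (intro borel_measurable_continuous_onI linear_continuous_on)
      (simp add: linear_conv_bounded_linear)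
  define h where
    "h = (\<lambda>x :: real ^ 'n. indicator (ball 0 1) x / emeasure lborel (ball 0 1 :: (real ^ 'n) set))"
  define D where "D = uniform_measure lborel (ball 0 1 :: (real ^ 'n) set)"
  have D: "D = density lborel h"
    by (simp add: D_def uniform_measure_def h_def)
  have [measurable]: "h \<in> borel_measurable borel"
    unfolding h_def by (intro borel_measurable_divide_ennreal borel_measurable_indicator) auto
  have [measurable_cong]: "sets D = sets borel"
    by (simp add: D_def)
  \<comment> \<open>The density of the uniform measure on the ball depends on the norm
    alone.\<close>
  have "h (f x) = h x" for x
    by (simp add: h_def f(2) indicator_def)
  then have "distr D borel f = density (distr lborel borel f) h"
    by (subst density_distr) (auto simp: D)
  then have inv: "distr D borel f = D"
    by (simp add: f(3) D)
  have "distr sphere_measure borel f = distr D borel (\<lambda>x. f (x /\<^sub>R norm x))"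
    unfolding sphere_measure_def D_def[symmetric] by (subst distr_distr) (auto simp: o_def)
  also have "\<dots> = distr D borel (\<lambda>x. f x /\<^sub>R norm (f x))"
    using f by (simp add: linear_scale)
  also have "\<dots> = distr (distr D borel f) borel (\<lambda>x. x /\<^sub>R norm x)"
    by (subst distr_distr) (auto simp: o_def)
  also have "\<dots> = sphere_measure"
    by (simp only: inv) (simp add: sphere_measure_def D_def)
  finally have "(\<integral>x. g x \<partial>sphere_measure) = (\<integral>x. g x \<partial>distr sphere_measure borel f)"
    by simp
  also have "\<dots> = (\<integral>x. g (f x) \<partial>sphere_measure)"
    by (rule integral_distr) (auto simp: sphere_measure_def)
  finally show ?thesis
    by simp
qed

lemma norm_eq_sqrt_sum_Basis: "norm x = sqrt (\<Sum>b\<in>Basis. (x \<bullet> b) * (x \<bullet> b))"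
  unfolding norm_eq_sqrt_inner by (subst euclidean_inner) (rule refl)

lemma integral_sphere_measure_permute_Basis:
  fixes p :: "real ^ 'n \<Rightarrow> real ^ 'n" and g :: "real ^ 'n \<Rightarrow> real"
  assumes p: "bij_betw p Basis Basis" and g: "g \<in> borel_measurable borel"
  shows "(\<integral>x. g (\<Sum>b\<in>Basis. (x \<bullet> p b) *\<^sub>R b) \<partial>sphere_measure) = (\<integral>x. g x \<partial>sphere_measure)"
proof (rule integral_sphere_measure_isometry[OF _ _ distr_lborel_permute_Basis[OF p] g])
  show "linear (\<lambda>x. \<Sum>b\<in>Basis. (x \<bullet> p b) *\<^sub>R b)"
    by (intro linearI) (simp_all add: inner_add_left scaleR_add_left sum.distrib scaleR_sum_right)
  show "norm (\<Sum>b\<in>Basis. (x \<bullet> p b) *\<^sub>R b) = norm x" for x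
    using sum.reindex_bij_betw[OF p, of "\<lambda>b. (x \<bullet> b) * (x \<bullet> b)"]
    by (simp add: norm_eq_sqrt_sum_Basis)
qed

lemma integral_sphere_measure_change_signs:
  fixes c :: "real ^ 'n \<Rightarrow> real" and g :: "real ^ 'n \<Rightarrow> real"
  assumes c: "\<And>b. b \<in> Basis \<Longrightarrow> \<bar>c b\<bar> = 1" and g: "g \<in> borel_measurable borel"
  shows "(\<integral>x. g (\<Sum>b\<in>Basis. (c b * (x \<bullet> b)) *\<^sub>R b) \<partial>sphere_measure) = (\<integral>x. g x \<partial>sphere_measure)"
proof (rule integral_sphere_measure_isometry[OF _ _ distr_lborel_change_signs[OF c] g])
  show "linear (\<lambda>x. \<Sum>b\<in>Basis. (c b * (x \<bullet> b)) *\<^sub>R b)"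
    by (intro linearI)
      (simp_all add: inner_add_left algebra_simps sum.distrib scaleR_sum_right)
  have "c b * c b = 1" if "b \<in> Basis" for b
    using c[OF that] by (metis abs_mult_self_eq mult_1)
  then have "(\<Sum>b\<in>Basis. (c b * (x \<bullet> b)) * (c b * (x \<bullet> b))) = (\<Sum>b\<in>Basis. (x \<bullet> b) * (x \<bullet> b))" for x
    by (intro sum.cong) (auto simp: algebra_simps)
  then show "norm (\<Sum>b\<in>Basis. (c b * (x \<bullet> b)) *\<^sub>R b) = norm x" for x
    by (simp add: norm_eq_sqrt_sum_Basis)
qed

section \<open>First and second moments of a design\<close>

lemma spherical_design_sum_inner:
  fixes X :: "(real ^ 'n) set"
  assumes "spherical_design t X" "1 \<le> t"
  shows "(\<Sum>x\<in>X. x \<bullet> y) = 0"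
proof -
  have "1 / real (card X) * (\<Sum>x\<in>X. x \<bullet> y) = (\<integral>x. x \<bullet> y \<partial>sphere_measure)"
    using assms polynomial_of_degree_le_inner unfolding spherical_design_def by blast
  \<comment> \<open>Changing all signs is the antipodal map, under which a linear form is odd; its
    integral equals its own negative.\<close>
  also have "\<dots> = 0"
  proof -
    have "(\<Sum>b\<in>Basis. (- 1 * (x \<bullet> b)) *\<^sub>R b) = - x" for x :: "real ^ 'n"
      by (simp add: sum_negf euclidean_representation)
    then show ?thesis
      using integral_sphere_measure_change_signs[of "\<lambda>_. - 1" "\<lambda>x. x \<bullet> y"] by simp
  qed
  finally show ?thesis
    using assms by (auto simp: spherical_design_def card_eq_0_iff)
qed

text \<open>Symmetry makes the second-moment matrix a multiple of the identity, and the unit norm of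
  the points fixes its trace as \<open>card X\<close>.\<close>

lemma spherical_design_sum_inner_power2:
  fixes X :: "(real ^ 'n) set"
  assumes X: "spherical_design t X" and t: "2 \<le> t"
  shows "(\<Sum>x\<in>X. (x \<bullet> y)\<^sup>2) = real (card X) / real CARD('n) * (norm y)\<^sup>2"
proof -
  define A where "A b b' = (\<Sum>x\<in>X. (x \<bullet> b) * (x \<bullet> b'))" for b b'
  have integral: "1 / real (card X) * A b b' = (\<integral>x. (x \<bullet> b) * (x \<bullet> b') \<partial>sphere_measure)" for b b'
    using X polynomial_of_degree_le_inner_mult[OF t] unfolding spherical_design_def A_def by blast
  \<comment> \<open>Proportionality of sphere integrals carries over to sums over the design. If
    \<open>card X\<close> is 0, then \<open>X\<close> is empty and both sums vanish.\<close>
  have A_eqI: "A b b' = c * A v v'"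
    if "(\<integral>x. (x \<bullet> b) * (x \<bullet> b') \<partial>sphere_measure) = c * (\<integral>x. (x \<bullet> v) * (x \<bullet> v') \<partial>sphere_measure)"
    for b b' v v' c
    using that X unfolding integral[symmetric]
    by (auto simp: spherical_design_def card_eq_0_iff A_def)
  \<comment> \<open>Flipping the single coordinate \<open>b\<close> negates the integrand, so the
    entry equals its own negative.\<close>
  have off_diagonal: "A b b' = 0" if "b \<in> Basis" "b' \<in> Basis" "b \<noteq> b'" for b b'
    using A_eqI[of b b' "- 1" b b'] that
      integral_sphere_measure_change_signs[of "\<lambda>v. if v = b then - 1 else 1" "\<lambda>x. (x \<bullet> b) * (x \<bullet> b')"]
    by simp
  \<comment> \<open>Swapping the coordinates \<open>b\<close> and \<open>b'\<close> exchanges the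
    two diagonal integrals.\<close>
  have diagonal: "A b b = A b' b'" if b: "b \<in> Basis" "b' \<in> Basis" for b b'
  proof -
    have "bij_betw (Transposition.transpose b b') Basis Basis"
      using b by (intro permutes_imp_bij permutes_swap_id)
    then show ?thesis
      using A_eqI[of b' b' 1 b b] b
        integral_sphere_measure_permute_Basis[of "Transposition.transpose b b'" "\<lambda>x. (x \<bullet> b) * (x \<bullet> b)"]
      by simp
  qed
  have trace: "(\<Sum>b\<in>Basis. A b b) = real (card X)"
  proof -
    have "(\<Sum>b\<in>Basis. A b b) = (\<Sum>x\<in>X. x \<bullet> x)"
      unfolding A_def by (subst sum.swap) (simp flip: euclidean_inner)
    also have "\<dots> = (\<Sum>x\<in>X. 1)"
      using X by (intro sum.cong) (auto simp: spherical_design_def dot_square_norm)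
    finally show ?thesis
      by simp
  qed
  have A: "A b b' = (if b = b' then real (card X) / real CARD('n) else 0)"
    if b: "b \<in> Basis" "b' \<in> Basis" for b b'
  proof -
    have "(\<Sum>v\<in>Basis. A v v) = (\<Sum>v\<in>(Basis :: (real ^ 'n) set). A b b)"
      by (intro sum.cong refl diagonal[OF _ b(1)])
    then have "real CARD('n) * A b b = real (card X)"
      using trace by simp
    then show ?thesis
      using off_diagonal[OF b] by (auto simp: field_simps)
  qed
  have "(x \<bullet> y)\<^sup>2 =
      (\<Sum>b\<in>Basis. \<Sum>b'\<in>Basis. (y \<bullet> b) * (y \<bullet> b') * ((x \<bullet> b) * (x \<bullet> b')))" for x
    by (subst euclidean_inner) (simp add: power2_eq_square sum_product ac_simps)
  then have "(\<Sum>x\<in>X. (x \<bullet> y)\<^sup>2) =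
      (\<Sum>x\<in>X. \<Sum>b\<in>Basis. \<Sum>b'\<in>Basis. (y \<bullet> b) * (y \<bullet> b') * ((x \<bullet> b) * (x \<bullet> b')))"
    by simp
  also have "\<dots> = (\<Sum>b\<in>Basis. \<Sum>b'\<in>Basis. (y \<bullet> b) * (y \<bullet> b') * A b b')"
    unfolding A_def sum_distrib_left by (simp add: sum.swap[of _ Basis X])
  also have "\<dots> = (\<Sum>b\<in>Basis. (y \<bullet> b) * (y \<bullet> b) * (real (card X) / real CARD('n)))"
    by (simp add: A if_distrib cong: if_cong)
  also have "\<dots> = real (card X) / real CARD('n) * (y \<bullet> y)"
    by (subst euclidean_inner[of y]) (simp add: sum_distrib_left mult.commute)
  finally show ?thesis
    by (simp add: dot_square_norm)
qed

text \<open>Test with the constant 1: over the empty set the average is 0, but the total mass of the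
  sphere is 1.\<close>

lemma spherical_design_nonempty:
  fixes X :: "(real ^ 'n) set"
  assumes "spherical_design t X"
  shows "X \<noteq> {}"
proof -
  have "1 / real (card X) * (\<Sum>x\<in>X. 1) = (\<integral>x. 1 \<partial>(sphere_measure :: (real ^ 'n) measure))"
    using assms polynomial_of_degree_le_const unfolding spherical_design_def by blast
  then show ?thesis
    using sphere_measure_UNIV[where 'n = 'n] by (auto simp: sphere_measure_def)
qed

section \<open>Regular simplices from equal inner products\<close>

lemma regular_simplex_vertices_of_inner:
  fixes X :: "(real ^ 'n) set"
  assumes "finite X" and unit: "\<And>v. v \<in> X \<Longrightarrow> norm v = 1"
    and inner: "\<And>v w. v \<in> X \<Longrightarrow> w \<in> X \<Longrightarrow> v \<noteq> w \<Longrightarrow> v \<bullet> w = c" and "c \<noteq> 1"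
  shows "regular_simplex_vertices X"
  unfolding regular_simplex_vertices_def
proof
  show "\<not> affine_dependent X"
    unfolding affine_dependent_explicit_finite[OF \<open>finite X\<close>]
  proof safe
    fix a v
    assume a: "sum a X = 0" "(\<Sum>v\<in>X. a v *\<^sub>R v) = 0" and v: "v \<in> X" "a v \<noteq> 0"
    \<comment> \<open>Pair the dependence relation with \<open>v\<close>. The common value
      \<open>c\<close> contributes \<open>c * sum a X = 0\<close>, and only the excess
      \<open>1 - c\<close> at \<open>w = v\<close> remains.\<close>
    have "0 = (\<Sum>w\<in>X. a w *\<^sub>R w) \<bullet> v"
      using a by simp
    also have "\<dots> = (\<Sum>w\<in>X. a w * c + (if w = v then a w * (1 - c) else 0))"
      unfolding inner_sum_left using inner v unit
      by (intro sum.cong) (auto simp: dot_square_norm algebra_simps)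
    also have "\<dots> = a v * (1 - c)"
      using a v \<open>finite X\<close> by (simp add: sum.distrib flip: sum_distrib_right)
    finally show False
      using v \<open>c \<noteq> 1\<close> by simp
  qed
  have "dist v w = sqrt (2 - 2 * c)" if "v \<in> X" "w \<in> X" "v \<noteq> w" for v w
    using inner[OF that] unit[of v] unit[of w] that
    by (simp add: dist_norm norm_eq_sqrt_inner inner_diff inner_commute)
  then show "\<exists>l. \<forall>v\<in>X. \<forall>w\<in>X. v \<noteq> w \<longrightarrow> dist v w = l"
    by blast
qed

section \<open>Inner products of a 2-design with one unit vector\<close>

lemma spherical_2_design_max_inner:
  fixes X :: "(real ^ 'n) set"
  assumes X: "spherical_design 2 X" and y: "norm y = 1"
    and s: "\<And>x. x \<in> X \<Longrightarrow> y \<bullet> x \<le> s"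
  shows "1 / real CARD('n) \<le> s"
    and "s = 1 / real CARD('n) \<Longrightarrow> x \<in> X \<Longrightarrow> y \<bullet> x = s \<or> x = - y"
    and "s = 1 / real CARD('n) \<Longrightarrow> - y \<in> X \<and> card X = CARD('n) + 1"
proof -
  have fin: "finite X" and unit: "\<And>x. x \<in> X \<Longrightarrow> norm x = 1"
    using X by (auto simp: spherical_design_def)
  have pos: "card X > 0"
    using fin spherical_design_nonempty[OF X] by (simp add: card_gt_0_iff)
  have lower: "0 \<le> y \<bullet> x + 1" if "x \<in> X" for x
    using Cauchy_Schwarz_ineq2[of y x] y unit[OF that] by simp
  have nonneg: "0 \<le> (y \<bullet> x + 1) * (s - y \<bullet> x)" if "x \<in> X" for x
    using lower s that by simp
  \<comment> \<open>After expansion the linear term vanishes by the first moment, and the second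
    moment evaluates the quadratic one.\<close>
  have total: "(\<Sum>x\<in>X. (y \<bullet> x + 1) * (s - y \<bullet> x)) = real (card X) * (s - 1 / real CARD('n))"
  proof -
    have "(\<Sum>x\<in>X. (y \<bullet> x + 1) * (s - y \<bullet> x)) = (\<Sum>x\<in>X. s + (s - 1) * (x \<bullet> y) - (x \<bullet> y)\<^sup>2)"
      by (rule sum.cong) (auto simp: algebra_simps power2_eq_square inner_commute)
    also have "\<dots> = real (card X) * s + (s - 1) * (\<Sum>x\<in>X. x \<bullet> y) - (\<Sum>x\<in>X. (x \<bullet> y)\<^sup>2)"
      by (simp add: sum.distrib sum_subtractf sum_distrib_left)
    finally show ?thesis
      using spherical_design_sum_inner[OF X, of y] spherical_design_sum_inner_power2[OF X, of y] y
      by (simp add: algebra_simps)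
  qed
  have "0 \<le> real (card X) * (s - 1 / real CARD('n))"
    unfolding total[symmetric] by (intro sum_nonneg nonneg)
  then show "1 / real CARD('n) \<le> s"
    using pos by (simp add: zero_le_mult_iff)
  have two_values: "y \<bullet> x = s \<or> x = - y" if eq: "s = 1 / real CARD('n)" and x: "x \<in> X" for x
  proof -
    \<comment> \<open>In the equality case the nonnegative terms sum to 0, so each of them is
      0.\<close>
    have "(y \<bullet> x + 1) * (s - y \<bullet> x) = 0"
      using total nonneg x fin by (simp add: eq sum_nonneg_eq_0_iff)
    \<comment> \<open>Equality in Cauchy-Schwarz: the squared norm of \<open>x + y\<close> is
      \<open>2 + 2 * (y \<bullet> x) = 0\<close>.\<close>
    moreover have "x = - y" if "y \<bullet> x = - 1"
    proof -
      have "(norm (x + y))\<^sup>2 = (norm x)\<^sup>2 + (norm y)\<^sup>2 + 2 * (y \<bullet> x)"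
        unfolding power2_norm_eq_inner by (simp add: inner_add inner_commute)
      then have "x + y = 0"
        using that y unit[OF x] by simp
      then show ?thesis
        by (simp add: eq_neg_iff_add_eq_0)
    qed
    ultimately show ?thesis
      by (auto simp: add_eq_0_iff)
  qed
  then show "s = 1 / real CARD('n) \<Longrightarrow> x \<in> X \<Longrightarrow> y \<bullet> x = s \<or> x = - y" .
  show "- y \<in> X \<and> card X = CARD('n) + 1" if eq: "s = 1 / real CARD('n)"
  proof -
    have "(\<Sum>x\<in>X. y \<bullet> x) = 0"
      using spherical_design_sum_inner[OF X, of y] by (simp add: inner_commute)
    \<comment> \<open>Each point contributes \<open>s\<close>, except that \<open>- y\<close>
      contributes \<open>- 1 = s - (1 + s)\<close>; as \<open>X\<close> is a set, this correction
      occurs at most once.\<close>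
    moreover have "(\<Sum>x\<in>X. y \<bullet> x) = (\<Sum>x\<in>X. s - (if x = - y then 1 + s else 0))"
      using two_values[OF eq] y by (intro sum.cong) (auto simp: dot_square_norm)
    moreover have "\<dots> = real (card X) * s - (if - y \<in> X then 1 + s else 0)"
      using fin by (simp add: sum_subtractf)
    ultimately have *: "real (card X) * s = (if - y \<in> X then 1 + s else 0)"
      by simp
    \<comment> \<open>Otherwise \<open>card X * s\<close> would be 0, although both factors are
      positive. With \<open>- y\<close> present, \<open>card X * s = 1 + s\<close> gives the
      cardinality.\<close>
    then have "- y \<in> X"
      using pos eq by (auto split: if_splits)
    moreover from this * have "real (card X) = real CARD('n) + 1"
      using eq by (simp add: field_simps)
    ultimately show ?thesis
      by linarith
  qed
qed

section \<open>From single vectors to the permutation and the simplex\<close>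

theorem theorem8p1:
  fixes x :: "nat \<Rightarrow> real ^ 'n" and N :: nat and U :: "real ^ 'n ^ 'n"
  assumes "CARD('n) \<ge> 2"
    and "inj_on x {1..N}"
    and "spherical_design 2 (x ` {1..N})"
    and "orthogonal_matrix U"
  shows "Max {(U *v x i) \<bullet> x j | i j. i \<in> {1..N} \<and> j \<in> {1..N}} \<ge> 1 / real CARD('n) \<and>
    (Max {(U *v x i) \<bullet> x j | i j. i \<in> {1..N} \<and> j \<in> {1..N}} = 1 / real CARD('n) \<longrightarrow>
       N = CARD('n) + 1 \<and>
       regular_simplex_vertices (x ` {1..N}) \<and>
       (\<exists>\<pi>. \<pi> permutes {1..N} \<and> (\<forall>i\<in>{1..N}. U *v x i = - x (\<pi> i))))"
proof -
  let ?S = "{(U *v x i) \<bullet> x j | i j. i \<in> {1..N} \<and> j \<in> {1..N}}"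
  let ?X = "x ` {1..N}"
  define s where "s = Max ?S"
  note inj = assms(2) and X = assms(3)
  have unit: "norm (x i) = 1" if "i \<in> {1..N}" for i
    using X imageI[OF that, of x] by (auto simp: spherical_design_def)
  have U: "orthogonal_transformation ((*v) U)"
    using assms(4) by (simp add: orthogonal_transformation_matrix)
  have unitU: "norm (U *v x i) = 1" if "i \<in> {1..N}" for i
    using orthogonal_transformation_norm[OF U] unit[OF that] by simp
  have "?S = (\<lambda>(i, j). (U *v x i) \<bullet> x j) ` ({1..N} \<times> {1..N})"
    by (force simp: image_iff)
  then have "finite ?S"
    by simp
  then have s: "(U *v x i) \<bullet> v \<le> s" if "i \<in> {1..N}" "v \<in> ?X" for i v
    unfolding s_def using that by (intro Max_ge \<open>finite ?S\<close>) blast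
  have "1 \<in> {1..N}"
    using spherical_design_nonempty[OF X] by auto
  have "1 / real CARD('n) \<le> s"
    using spherical_2_design_max_inner(1)[OF X unitU s] \<open>1 \<in> {1..N}\<close> by blast
  moreover have "N = CARD('n) + 1 \<and> regular_simplex_vertices ?X \<and>
       (\<exists>\<pi>. \<pi> permutes {1..N} \<and> (\<forall>i\<in>{1..N}. U *v x i = - x (\<pi> i)))"
    if eq: "s = 1 / real CARD('n)"
  proof (intro conjI)
    \<comment> \<open>The bound \<open>s\<close> is common to all \<open>i\<close>, so the equality
      case applies to every \<open>U *v x i\<close>, not just to one attaining the maximum.\<close>
    have antipode: "- (U *v x i) \<in> ?X \<and> card ?X = CARD('n) + 1" if "i \<in> {1..N}" for i
      using spherical_2_design_max_inner(3)[OF X unitU s eq] that by blast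
    show "N = CARD('n) + 1"
      using antipode[OF \<open>1 \<in> {1..N}\<close>] inj by (simp add: card_image)
    have "\<forall>i\<in>{1..N}. \<exists>j\<in>{1..N}. x j = - (U *v x i)"
      using antipode by (metis imageE)
    then obtain p where p: "\<And>i. i \<in> {1..N} \<Longrightarrow> p i \<in> {1..N} \<and> x (p i) = - (U *v x i)"
      by metis
    \<comment> \<open>Injectivity of \<open>U\<close> and of \<open>x\<close> passes to
      \<open>p\<close>, and an injective self-map of a finite set is bijective.\<close>
    have "inj_on p {1..N}"
    proof (rule inj_onI)
      fix i j assume ij: "i \<in> {1..N}" "j \<in> {1..N}" "p i = p j"
      then have "U *v x i = U *v x j"
        using p by (metis neg_equal_iff_equal)
      then have "x i = x j"
        by (rule injD[OF orthogonal_transformation_inj[OF U]])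
      then show "i = j"
        by (rule inj_onD[OF inj _ ij(1,2)])
    qed
    then have bij: "bij_betw p {1..N} {1..N}"
      unfolding bij_betw_def using p endo_inj_surj[of "{1..N}" p] by blast
    \<comment> \<open>\<open>permutes\<close> demands the identity outside
      \<open>{1..N}\<close>.\<close>
    define \<pi> where "\<pi> i = (if i \<in> {1..N} then p i else i)" for i
    have "bij_betw \<pi> {1..N} {1..N} = bij_betw p {1..N} {1..N}"
      by (rule bij_betw_cong) (simp add: \<pi>_def)
    with bij have "bij_betw \<pi> {1..N} {1..N}"
      by blast
    then have "\<pi> permutes {1..N}"
      by (rule bij_imp_permutes) (auto simp: \<pi>_def)
    moreover have "\<forall>i\<in>{1..N}. U *v x i = - x (\<pi> i)"
      using p by (simp add: \<pi>_def)
    ultimately show "\<exists>\<pi>. \<pi> permutes {1..N} \<and> (\<forall>i\<in>{1..N}. U *v x i = - x (\<pi> i))"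
      by blast
    show "regular_simplex_vertices ?X"
    proof (rule regular_simplex_vertices_of_inner)
      fix v w assume vw: "v \<in> ?X" "w \<in> ?X" "v \<noteq> w"
      \<comment> \<open>Surjectivity of \<open>p\<close> writes every point as some
        \<open>- (U *v x i)\<close>. A different point \<open>w\<close> is then not the antipode of
        \<open>U *v x i\<close>, which leaves the value \<open>s\<close>.\<close>
      then obtain i where i: "i \<in> {1..N}" "v = - (U *v x i)"
        using bij p by (metis bij_betw_imp_surj_on imageE)
      then have "(U *v x i) \<bullet> w = s"
        using spherical_2_design_max_inner(2)[OF X unitU[OF i(1)] s[OF i(1)] eq vw(2)] vw(3) by blast
      then show "v \<bullet> w = - s"
        using i by simp
    next
      show "- s \<noteq> 1"
        using eq zero_le_divide_1_iff[of "real CARD('n)"] by linarith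
    qed (use unit in auto)
  qed
  ultimately show ?thesis
    unfolding s_def by blast
qed

end
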